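(* Let $\mathbf{H}\in\mathbb{C}^{M\times N}$, $\mathbf{G}\in\mathbb{C}^{N\times N}$, $\mathbf{u}^{\mathrm{in}}\in\mathbb{C}^N$ and $\mathbf{y}\in\mathbb{C}^M$ be fixed. For $\mathbf{f}\in\mathbb{R}^N$ put $\mathbf{A}=\mathbf{A}(\mathbf{f}):=\mathbf{I}-\mathbf{G}\,\mathrm{diag}(\mathbf{f})$ and, whenever $\mathbf{A}(\mathbf{f})$ is non-singular, $\mathbf{u}=\mathbf{u}(\mathbf{f}):=\mathbf{A}^{-1}\mathbf{u}^{\mathrm{in}}$, $\mathcal{Z}(\mathbf{f}):=\mathbf{H}\,\mathrm{diag}(\mathbf{u})\,\mathbf{f}\in\mathbb{C}^M$ and $\mathcal{D}(\mathbf{f}):=\frac12\|\mathbf{y}-\mathcal{Z}(\mathbf{f})\|_2^2$. Let $\mathbf{f}\in\mathbb{R}^N$ be such that $\mathbf{A}(\mathbf{f})$ is non-singular and let $\mathbf{w}=\mathcal{Z}(\mathbf{f})-\mathbf{y}$. Then $$\nabla\mathcal{D}(\mathbf{f})=\mathrm{Re}\left\{\mathrm{diag}(\mathbf{u})^{\mathsf H}\left(\mathbf{H}^{\mathsf H}\mathbf{w}+\mathbf{G}^{\mathsf H}\mathbf{v}\right)\right\},$$ where $\mathbf{u}$ and $\mathbf{v}$ are obtained from the linear systems $$\mathbf{A}\mathbf{u}=\mathbf{u}^{\mathrm{in}},\qquad \mathbf{A}^{\mathsf H}\mathbf{v}=\mathrm{diag}(\mathbf{f})\,\mathbf{H}^{\mathsf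 H}\mathbf{w}.$$
   Context: $\mathrm{diag}(\mathbf{a})$ is the diagonal matrix with the vector $\mathbf{a}$ on its diagonal; $(\cdot)^{\mathsf H}$ is the conjugate transpose; $\mathrm{Re}$ is the entrywise real part; $\mathbf{I}$ is the identity matrix. $\nabla\mathcal{D}(\mathbf{f})\in\mathbb{R}^N$ is the gradient of the real-valued function $\mathcal{D}$ with respect to the real vector $\mathbf{f}$. (In the application, $\mathbf{f}$ is a sampled real permittivity contrast, $\mathbf{u}$ the total field, $\mathbf{u}^{\mathrm{in}}$ the incident field, $\mathbf{y}$ the measured scattered wave, and $\mathbf{H},\mathbf{G}$ are discretizations of the free-space Green's function.) *)

theory Defs
  imports "HOL-Analysis.Analysis"
begin

definition diag :: "'a::zero ^ 'n \<Rightarrow> 'a ^ 'n ^ 'n" where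
  "diag a = (\<chi> i j. if i = j then a $ i else 0)"

definition conj_transpose :: "complex ^ 'n ^ 'm \<Rightarrow> complex ^ 'm ^ 'n" where
  "conj_transpose B = transpose (map_matrix cnj B)"

definition Re_vec :: "complex ^ 'n \<Rightarrow> real ^ 'n" where
  "Re_vec z = (\<chi> i. Re (z $ i))"

definition complex_vec :: "real ^ 'n \<Rightarrow> complex ^ 'n" where
  "complex_vec f = (\<chi> i. complex_of_real (f $ i))"

definition system_matrix :: "complex ^ 'n ^ 'n \<Rightarrow> real ^ 'n \<Rightarrow> complex ^ 'n ^ 'n" where
  "system_matrix G f = mat 1 - G ** diag (complex_vec f)"

text \<open>
  The following functions of \<open>f\<close> are meaningful only where \<open>system_matrix G f\<close> is invertible;
  elsewhere \<^const>\<open>matrix_inv\<close> is an arbitrary matrix. Since the set of \<open>f\<close> with an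
  invertible system matrix is open, these values do not affect derivatives at such an \<open>f\<close>.
\<close>

definition total_field :: "complex ^ 'n ^ 'n \<Rightarrow> complex ^ 'n \<Rightarrow> real ^ 'n \<Rightarrow> complex ^ 'n" where
  "total_field G u\<^sub>i\<^sub>n f = matrix_inv (system_matrix G f) *v u\<^sub>i\<^sub>n"

definition scattered_field ::
  "complex ^ 'n ^ 'm \<Rightarrow> complex ^ 'n ^ 'n \<Rightarrow> complex ^ 'n \<Rightarrow> real ^ 'n \<Rightarrow> complex ^ 'm" where
  "scattered_field H G u\<^sub>i\<^sub>n f = (H ** diag (total_field G u\<^sub>i\<^sub>n f)) *v complex_vec f"

definition data_fidelity ::
  "complex ^ 'n ^ 'm \<Rightarrow> complex ^ 'n ^ 'n \<Rightarrow> complex ^ 'n \<Rightarrow> complex ^ 'm \<Rightarrow> real ^ 'n \<Rightarrow> real" where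
  "data_fidelity H G u\<^sub>i\<^sub>n y f = 1 / 2 * (norm (y - scattered_field H G u\<^sub>i\<^sub>n f))\<^sup>2"

end

theory Submission
  imports Defs
begin

text \<open>
  Write \<open>A(g)\<close> for the system matrix and \<open>u(g)\<close> for the total field at \<open>g\<close>.
  Subtracting \<open>A(f) u(f) = u\<^sub>i\<^sub>n\<close> from \<open>A(g) u(g) = u\<^sub>i\<^sub>n\<close> gives
  \<open>u(g) - u(f) = A(f)\<^sup>-\<^sup>1 G diag(g - f) u(g)\<close>. The right-hand side is bilinear in \<open>g - f\<close> and
  \<open>u(g)\<close>, so this identity alone yields continuity of \<open>u\<close> at \<open>f\<close> and then its derivative
  \<open>u'(h) = A(f)\<^sup>-\<^sup>1 G diag(h) u(f)\<close>. In the derivative \<open>Re \<langle>w, H (diag(f) u'(h) + diag(h) u)\<rangle>\<close> of the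
  data fidelity, the adjoint equation for \<open>v\<close> turns the first term into
  \<open>Re \<langle>v, A(f) u'(h)\<rangle> = Re \<langle>v, G diag(h) u\<rangle>\<close>. The real inner product of the library
  on \<^typ>\<open>complex ^ 'n\<close> is exactly the real part of the Hermitian one.
\<close>

lemma diag_mult_vec: "diag a *v x = (\<chi> i. a $ i * x $ i)" for a x :: "'a::semiring_1 ^ 'n"
  by (simp add: diag_def matrix_vector_mult_def vec_eq_iff if_distrib[of "\<lambda>t. t * _"] cong: if_cong)

lemma diag_mult_vec_commute: "diag a *v x = diag x *v a" for a x :: "'a::comm_semiring_1 ^ 'n"
  by (simp add: diag_mult_vec mult.commute)

text \<open>Linearity is over the reals here: \<open>f\<close> is a real vector, so every derivative
  below is a real-linear map into a complex space.\<close>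

lemma bounded_linear_matrix_vector_complex: "bounded_linear ((*v) (B :: complex ^ 'n ^ 'm))"
  by (intro linear_conv_bounded_linear[THEN iffD1] linearI)
    (simp_all add: matrix_vector_right_distrib, simp add: matrix_vector_mult_def vec_eq_iff scaleR_sum_right)

lemma bounded_bilinear_diag_complex_vec:
  "bounded_bilinear (\<lambda>h x. diag (complex_vec h) *v x)"
  unfolding bilinear_conv_bounded_bilinear[symmetric] bilinear_def diag_mult_vec complex_vec_def
  by (intro conjI allI linearI) (simp_all add: vec_eq_iff algebra_simps, simp add: scaleR_conv_of_real)

text \<open>On \<open>complex\<close> the real inner product of \<open>a\<close> and
  \<open>b\<close> is the real part of \<open>cnj a * b\<close>, so a factor changes sides by being
  conjugated.\<close>

lemma inner_conj_transpose:
  "inner x (B *v z) = inner (conj_transpose B *v x) z" for B :: "complex ^ 'n ^ 'm"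
proof -
  have "inner x (B *v z) = (\<Sum>i\<in>UNIV. \<Sum>j\<in>UNIV. inner (x $ i) (B $ i $ j * z $ j))"
    by (simp add: inner_vec_def matrix_vector_mult_def inner_sum_right)
  also have "\<dots> = (\<Sum>j\<in>UNIV. \<Sum>i\<in>UNIV. inner (cnj (B $ i $ j) * x $ i) (z $ j))"
    by (subst sum.swap) (simp add: inner_complex_def algebra_simps)
  also have "\<dots> = inner (conj_transpose B *v x) z"
    by (simp add: inner_vec_def matrix_vector_mult_def conj_transpose_def transpose_def
        map_matrix_def inner_sum_left)
  finally show ?thesis .
qed

lemma conj_transpose_mult:
  "conj_transpose (B ** C) = conj_transpose C ** conj_transpose B"
  for B :: "complex ^ 'n ^ 'm" and C :: "complex ^ 'k ^ 'n"
  by (simp add: conj_transpose_def map_matrix_def transpose_def matrix_matrix_mult_def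
      vec_eq_iff mult.commute)

lemma conj_transpose_mat_1: "conj_transpose (mat 1) = mat 1"
  by (simp add: conj_transpose_def map_matrix_def transpose_def mat_def vec_eq_iff)

lemma invertible_conj_transpose:
  "invertible B \<Longrightarrow> invertible (conj_transpose B)" for B :: "complex ^ 'n ^ 'n"
  unfolding invertible_def by (metis conj_transpose_mult conj_transpose_mat_1)

lemma invertible_ex1_solution:
  "invertible B \<Longrightarrow> \<exists>!x. B *v x = b" for B :: "'a::semiring_1 ^ 'n ^ 'n"
  unfolding invertible_def
  by (metis matrix_vector_mul_assoc matrix_vector_mul_lid)

lemma matrix_inv_vec:
  assumes "invertible B"
  shows matrix_inv_vec_right: "B *v (matrix_inv B *v x) = x"
    and matrix_inv_vec_left: "matrix_inv B *v (B *v x) = x"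
  using someI_ex[OF assms[unfolded invertible_def]]
  by (simp_all add: matrix_inv_def matrix_vector_mul_assoc)

text \<open>No regularity of \<open>u\<close> is assumed. Near \<open>f\<close> the equation absorbs
  \<open>norm (u g)\<close> into a multiple of \<open>norm (u f)\<close>; substituting this bound
  back into the equation makes the remainder quadratic in \<open>g - f\<close>.\<close>

lemma has_derivative_bilinear_fixpoint:
  fixes L :: "'a::real_normed_vector \<Rightarrow> 'b::real_normed_vector \<Rightarrow> 'b"
  assumes L: "bounded_bilinear L"
    and ev: "eventually (\<lambda>g. u g - u f = L (g - f) (u g)) (at f)"
  shows "(u has_derivative (\<lambda>h. L h (u f))) (at f)"
proof -
  interpret bounded_bilinear L by fact
  obtain K where K: "K > 0" "\<And>h x. norm (L h x) \<le> norm h * norm x * K"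
    using pos_bounded by blast
  obtain d where d: "d > 0" "\<And>g. g \<noteq> f \<Longrightarrow> dist g f < d \<Longrightarrow> u g - u f = L (g - f) (u g)"
    using ev unfolding eventually_at by auto
  show ?thesis
  \<comment> \<open>Radius \<open>d\<close> secures the equation; \<open>1 / (2 * K)\<close> makes
    \<open>L (g - f)\<close> at most halve norms.\<close>
  proof (rule has_derivativeI_sandwich[where e = "min d (1 / (2 * K))"])
    show "((\<lambda>g. 2 * K\<^sup>2 * norm (u f) * norm (g - f)) \<longlongrightarrow> 0) (at f)"
      by (intro tendsto_eq_intros | simp)+
    fix g assume g: "g \<noteq> f" "dist g f < min d (1 / (2 * K))"
    have eq: "u g - u f = L (g - f) (u g)" using d(2) g by auto
    have half: "norm (g - f) * K \<le> 1 / 2"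
      using g K(1) by (simp add: dist_norm field_simps)
    have diff: "norm (u g - u f) \<le> norm (g - f) * K * norm (u g)"
      using K(2)[of "g - f" "u g"] by (simp add: eq mult.assoc mult.commute mult.left_commute)
    have "norm (u g) \<le> norm (u f) + norm (u g - u f)"
      by (metis add.commute diff_add_cancel norm_triangle_ineq)
    also have "\<dots> \<le> norm (u f) + 1 / 2 * norm (u g)"
      using diff mult_right_mono[OF half, of "norm (u g)"] by simp
    finally have "norm (u g) \<le> 2 * norm (u f)" by simp
    then have "norm (u g - u f) \<le> norm (g - f) * K * (2 * norm (u f))"
      using diff K(1) by (meson mult_left_mono mult_nonneg_nonneg norm_ge_zero order.trans less_imp_le)
    \<comment> \<open>This is the remainder: by the equation,
      \<open>u g - u f - L (g - f) (u f)\<close> equals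
      \<open>L (g - f) (u g - u f)\<close>.\<close>
    then have "norm (L (g - f) (u g - u f)) \<le> norm (g - f) * (norm (g - f) * K * (2 * norm (u f))) * K"
      using K(1) by (intro order.trans[OF K(2)] mult_right_mono mult_left_mono) auto
    then have "norm (u g - u f - L (g - f) (u f)) \<le> 2 * K\<^sup>2 * norm (u f) * norm (g - f) * norm (g - f)"
      by (simp add: eq diff_right power2_eq_square algebra_simps flip: eq)
    then show "norm (u g - u f - L (g - f) (u f)) / norm (g - f) \<le> 2 * K\<^sup>2 * norm (u f) * norm (g - f)"
      using g by (simp add: field_simps)
  qed (use d K in \<open>auto intro: bounded_linear_left\<close>)
qed

lemma system_matrix_diff:
  "system_matrix G f *v x - system_matrix G g *v x = G *v (diag (complex_vec (g - f)) *v x)"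
proof -
  have "diag (complex_vec g) *v x - diag (complex_vec f) *v x = diag (complex_vec (g - f)) *v x"
    by (simp add: diag_mult_vec complex_vec_def vec_eq_iff algebra_simps)
  then show ?thesis
    by (simp add: system_matrix_def matrix_vector_mult_diff_rdistrib flip: matrix_vector_mul_assoc
        matrix_vector_mult_diff_distrib)
qed

lemma system_matrix_total_field:
  "invertible (system_matrix G f) \<Longrightarrow> system_matrix G f *v total_field G b f = b"
  by (simp add: total_field_def matrix_inv_vec_right)

text \<open>With \<open>B\<close> the inverse of the system matrix at \<open>f\<close>, this map
  controls both invertibility near \<open>f\<close> and the derivative of the total field.\<close>

lemma bounded_bilinear_resolvent:
  "bounded_bilinear (\<lambda>h x. B *v (G *v (diag (complex_vec h) *v x)))"
  for B G :: "complex ^ 'n ^ 'n"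
proof -
  note comp = bounded_linear_compose[OF bounded_linear_matrix_vector_complex]
  show ?thesis
    using bounded_bilinear_diag_complex_vec
    unfolding bilinear_conv_bounded_bilinear[symmetric] bilinear_def linear_conv_bounded_linear
    by (intro conjI allI comp) auto
qed

text \<open>A kernel vector \<open>x\<close> of the system matrix at \<open>g\<close> satisfies
  \<open>x = L (g - f) x\<close>; for \<open>g\<close> within \<open>1 / K\<close> of
  \<open>f\<close> this map strictly shrinks nonzero vectors, which forces
  \<open>x = 0\<close>.\<close>

lemma eventually_invertible_system_matrix:
  assumes "invertible (system_matrix G f)"
  shows "eventually (\<lambda>g. invertible (system_matrix G g)) (at f)"
proof -
  define B where "B = matrix_inv (system_matrix G f)"
  define L where "L = (\<lambda>h x. B *v (G *v (diag (complex_vec h) *v x)))"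
  obtain K where K: "K > 0" "\<And>h x. norm (L h x) \<le> norm h * norm x * K"
    using bounded_bilinear.pos_bounded[OF bounded_bilinear_resolvent] unfolding L_def by blast
  show ?thesis unfolding eventually_at
  proof (intro exI[of _ "1 / K"] conjI ballI impI)
    fix g assume g: "g \<noteq> f \<and> dist g f < 1 / K"
    have "x = 0" if "system_matrix G g *v x = 0" for x
    proof (rule ccontr)
      assume "x \<noteq> 0"
      have "x = B *v (system_matrix G f *v x)"
        by (simp add: B_def matrix_inv_vec_left assms)
      also have "\<dots> = L (g - f) x"
        using system_matrix_diff[of G f x g] that by (simp add: L_def)
      finally have "norm x \<le> norm (g - f) * norm x * K" using K(2) by metis
      moreover have "norm (g - f) * K < 1" using g K(1) by (simp add: dist_norm field_simps)
      ultimately show False using \<open>x \<noteq> 0\<close>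
        by (metis mult.assoc mult.commute mult_less_cancel_right2 norm_le_zero_iff not_le)
    qed
    then show "invertible (system_matrix G g)"
      unfolding invertible_left_inverse matrix_left_invertible_ker by blast
  qed (use K in auto)
qed

lemma has_derivative_total_field:
  assumes inv: "invertible (system_matrix G f)"
  shows "(total_field G b has_derivative (\<lambda>h. matrix_inv (system_matrix G f) *v
    (G *v (diag (complex_vec h) *v total_field G b f)))) (at f)"
proof (rule has_derivative_bilinear_fixpoint[OF bounded_bilinear_resolvent])
  let ?B = "matrix_inv (system_matrix G f)" and ?u = "total_field G b"
  show "eventually (\<lambda>g. ?u g - ?u f = ?B *v (G *v (diag (complex_vec (g - f)) *v ?u g))) (at f)"
    using eventually_invertible_system_matrix[OF inv]
  proof eventually_elim
    case (elim g)
    have "?B *v (G *v (diag (complex_vec (g - f)) *v ?u g)) = ?B *v (system_matrix G f *v ?u g - b)"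
      using system_matrix_total_field[OF elim, of b] by (simp only: flip: system_matrix_diff)
    also have "\<dots> = ?u g - ?u f"
      using matrix_inv_vec_left[OF inv, of "?u g"]
      by (simp only: matrix_vector_mult_diff_distrib) (simp only: total_field_def)
    finally show ?case ..
  qed
qed

text \<open>Swapping the two vectors exposes the bilinear map in \<open>f\<close> and the total
  field, ready for the product rule.\<close>

lemma scattered_field_alt:
  "scattered_field H G b f = H *v (diag (complex_vec f) *v total_field G b f)"
  by (simp add: scattered_field_def diag_mult_vec_commute flip: matrix_vector_mul_assoc)

lemma inner_Re_vec: "inner h (Re_vec z) = inner (complex_vec h) z"
  by (simp add: inner_vec_def Re_vec_def complex_vec_def inner_complex_def)

lemma GDERIV_data_fidelity:
  assumes inv: "invertible (system_matrix G f)"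
    and w: "w = scattered_field H G b f - y"
    and u: "u = total_field G b f"
    and v: "conj_transpose (system_matrix G f) *v v
      = (diag (complex_vec f) ** conj_transpose H) *v w"
  shows "GDERIV (data_fidelity H G b y) f :>
    Re_vec (conj_transpose (diag u) *v (conj_transpose H *v w + conj_transpose G *v v))"
proof -
  define du where "du = (\<lambda>h. matrix_inv (system_matrix G f) *v (G *v (diag (complex_vec h) *v u)))"
  define dZ where "dZ = (\<lambda>h. H *v (diag (complex_vec f) *v du h + diag (complex_vec h) *v u))"
  have "(total_field G b has_derivative du) (at f)"
    unfolding du_def u by (rule has_derivative_total_field[OF inv])
  then have dZ: "(scattered_field H G b has_derivative dZ) (at f)"
    unfolding scattered_field_alt[abs_def] dZ_def u
    by (intro bounded_linear.has_derivative[OF bounded_linear_matrix_vector_complex]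
        bounded_bilinear.FDERIV[OF bounded_bilinear_diag_complex_vec] has_derivative_ident)
  \<comment> \<open>At \<open>f\<close> the residual is \<open>- w\<close> and its derivative is
    \<open>- dZ h\<close>, so the signs cancel; the factor \<open>1 / 2\<close> absorbs the two
    equal terms of the product rule.\<close>
  have "((\<lambda>g. 1 / 2 * inner (y - scattered_field H G b g) (y - scattered_field H G b g))
      has_derivative (\<lambda>h. inner w (dZ h))) (at f)"
    by (rule derivative_eq_intros dZ refl)+
      (simp add: w inner_commute fun_eq_iff algebra_simps)
  moreover have "inner w (dZ h) = inner h
      (Re_vec (conj_transpose (diag u) *v (conj_transpose H *v w + conj_transpose G *v v)))" for h
  proof -
    \<comment> \<open>Conjugation has no effect because \<open>f\<close> is real.\<close>
    have diag_adj: "conj_transpose (diag (complex_vec f)) = diag (complex_vec f)"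
      by (simp add: conj_transpose_def map_matrix_def transpose_def diag_def complex_vec_def
          vec_eq_iff)
    have "inner w (H *v (diag (complex_vec f) *v du h))
        = inner (conj_transpose (system_matrix G f) *v v) (du h)"
      unfolding v by (simp add: inner_conj_transpose diag_adj flip: matrix_vector_mul_assoc)
    also have "\<dots> = inner v (system_matrix G f *v du h)"
      by (simp add: inner_conj_transpose)
    also have "\<dots> = inner v (G *v (diag (complex_vec h) *v u))"
      by (simp add: du_def matrix_inv_vec_right inv)
    \<comment> \<open>Writing \<open>diag u *v complex_vec h\<close> puts the direction
      \<open>h\<close> last, so that adjoints can move everything else to the other side.\<close>
    finally have "inner w (dZ h) =
        inner v (G *v (diag u *v complex_vec h)) + inner w (H *v (diag u *v complex_vec h))"
      by (simp add: dZ_def matrix_vector_right_distrib inner_add_right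
          diag_mult_vec_commute[of "complex_vec h"])
    then show ?thesis
      by (simp add: inner_conj_transpose inner_Re_vec inner_commute[of "complex_vec h"]
          matrix_vector_right_distrib inner_add_left)
  qed
  ultimately show ?thesis
    by (simp add: gderiv_def data_fidelity_def[abs_def] power2_norm_eq_inner)
qed

theorem proposition1:
  fixes H :: "complex ^ 'n ^ 'm" and G :: "complex ^ 'n ^ 'n"
    and u\<^sub>i\<^sub>n :: "complex ^ 'n" and y :: "complex ^ 'm"
    and f :: "real ^ 'n" and A :: "complex ^ 'n ^ 'n" and w :: "complex ^ 'm"
  assumes "A = system_matrix G f"
    and "invertible A"
    and "w = scattered_field H G u\<^sub>i\<^sub>n f - y"
  shows "(\<exists>!u. A *v u = u\<^sub>i\<^sub>n) \<and>
    (\<exists>!v. conj_transpose A *v v = (diag (complex_vec f) ** conj_transpose H) *v w) \<and>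
    (\<forall>u v. A *v u = u\<^sub>i\<^sub>n \<longrightarrow>
       conj_transpose A *v v = (diag (complex_vec f) ** conj_transpose H) *v w \<longrightarrow>
       GDERIV (data_fidelity H G u\<^sub>i\<^sub>n y) f :>
         Re_vec (conj_transpose (diag u) *v (conj_transpose H *v w + conj_transpose G *v v)))"
proof (intro conjI allI impI)
  show ex1: "\<exists>!u. A *v u = u\<^sub>i\<^sub>n"
    by (rule invertible_ex1_solution[OF assms(2)])
  show "\<exists>!v. conj_transpose A *v v = (diag (complex_vec f) ** conj_transpose H) *v w"
    by (rule invertible_ex1_solution[OF invertible_conj_transpose[OF assms(2)]])
  fix u v
  assume "A *v u = u\<^sub>i\<^sub>n"
    and v: "conj_transpose A *v v = (diag (complex_vec f) ** conj_transpose H) *v w"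
  \<comment> \<open>Unique solvability identifies an arbitrary solution with the field defined
    through \<open>matrix_inv\<close>.\<close>
  then have "u = total_field G u\<^sub>i\<^sub>n f"
    using ex1 assms(1,2) system_matrix_total_field by blast
  with assms v show "GDERIV (data_fidelity H G u\<^sub>i\<^sub>n y) f :>
      Re_vec (conj_transpose (diag u) *v (conj_transpose H *v w + conj_transpose G *v v))"
    by (intro GDERIV_data_fidelity) auto
qed

end
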